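(* Let $n\geq 1$ be an integer and let $\zeta\in\mathbb{R}$ be a real number that is not algebraic of degree $\leq n$. Then \[ w_{n}^{\ast}(\zeta)\geq \frac{1}{\widehat{w}_{n}^{\prime}(\zeta)} \qquad\text{and}\qquad \widehat{w}_{n}^{\ast}(\zeta)\geq \frac{1}{w_{n}^{\prime}(\zeta)}. \]
   Context: For an algebraic number $\alpha$, $H(\alpha)$ denotes the largest absolute value of the coefficients of its minimal polynomial over $\mathbb{Z}$ with relatively prime integer coefficients. $w_{n}^{\ast}(\zeta)$ is the supremum of all real $\nu$ such that $\vert\zeta-\alpha\vert\leq H(\alpha)^{-\nu-1}$ has infinitely many solutions $\alpha$ algebraic of degree $\leq n$. $\widehat{w}_{n}^{\ast}(\zeta)$ is the supremum of all real $\nu$ such that for every sufficiently large $H$ there exists an algebraic number $\alpha$ of degree $\leq n$ with $H(\alpha)\leq H$ and $\vert\zeta-\alpha\vert\leq H(\alpha)^{-1}H^{-\nu}$. $w_{n}^{\prime}(\zeta)$ (resp. $\widehat{w}_{n}^{\prime}(\zeta)$) is the supremum of all real $\nu$ such that the system $\vert x\vert\leq X$, $\vert \zeta^{i}x-y_{i}\vert\leq X^{-\nu}$ ($1\leq i\leq n$) has a nonzero integer solution $(x,y_{1},\ldots,y_{n})\in\mathbb{Z}^{n+1}$ for arbitrarily large values of $X$ (resp. for all sufficiently large $X$). The convention $1/\infty=0$ is used. *)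

theory Defs
  imports "HOL-Analysis.Analysis" "HOL-Computational_Algebra.Polynomial"
begin

definition int_root :: "int poly \<Rightarrow> real \<Rightarrow> bool" where
  "int_root p \<alpha> \<longleftrightarrow> p \<noteq> 0 \<and> poly (map_poly real_of_int p) \<alpha> = 0"

definition alg_deg_le :: "nat \<Rightarrow> real \<Rightarrow> bool" where
  "alg_deg_le n \<alpha> \<longleftrightarrow> (\<exists>p. int_root p \<alpha> \<and> degree p \<le> n)"

(* minimal polynomial over Z with relatively prime coefficients (unique up to sign) *)
definition int_minpoly :: "real \<Rightarrow> int poly \<Rightarrow> bool" where
  "int_minpoly \<alpha> p \<longleftrightarrow> int_root p \<alpha> \<and> content p = 1 \<and>
     (\<forall>q. int_root q \<alpha> \<longrightarrow> degree p \<le> degree q)"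

definition poly_height :: "int poly \<Rightarrow> int" where
  "poly_height p = Max ((\<lambda>i. \<bar>coeff p i\<bar>) ` {..degree p})"

definition H :: "real \<Rightarrow> real" where
  "H \<alpha> = (THE h. \<exists>p. int_minpoly \<alpha> p \<and> h = real_of_int (poly_height p))"

definition wstar :: "nat \<Rightarrow> real \<Rightarrow> ereal" where
  "wstar n \<zeta> = Sup (ereal ` {\<nu>. infinite {\<alpha>. alg_deg_le n \<alpha> \<and>
       \<bar>\<zeta> - \<alpha>\<bar> \<le> H \<alpha> powr (- \<nu> - 1)}})"

definition wstar_hat :: "nat \<Rightarrow> real \<Rightarrow> ereal" where
  "wstar_hat n \<zeta> = Sup (ereal ` {\<nu>. \<exists>H0. \<forall>Hb\<ge>H0. \<exists>\<alpha>. alg_deg_le n \<alpha> \<and>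
       H \<alpha> \<le> Hb \<and> \<bar>\<zeta> - \<alpha>\<bar> \<le> H \<alpha> powr (-1) * Hb powr (- \<nu>)})"

definition sim_sys :: "nat \<Rightarrow> real \<Rightarrow> real \<Rightarrow> real \<Rightarrow> bool" where
  "sim_sys n \<zeta> \<nu> X \<longleftrightarrow> (\<exists>(x::int) (y::nat \<Rightarrow> int).
      (x \<noteq> 0 \<or> (\<exists>i\<in>{1..n}. y i \<noteq> 0)) \<and> \<bar>real_of_int x\<bar> \<le> X \<and>
      (\<forall>i\<in>{1..n}. \<bar>\<zeta> ^ i * real_of_int x - real_of_int (y i)\<bar> \<le> X powr (- \<nu>)))"

definition wprime :: "nat \<Rightarrow> real \<Rightarrow> ereal" where
  "wprime n \<zeta> = Sup (ereal ` {\<nu>. \<forall>X0. \<exists>X\<ge>X0. sim_sys n \<zeta> \<nu> X})"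

definition wprime_hat :: "nat \<Rightarrow> real \<Rightarrow> ereal" where
  "wprime_hat n \<zeta> = Sup (ereal ` {\<nu>. \<exists>X0. \<forall>X\<ge>X0. sim_sys n \<zeta> \<nu> X})"

end

theory Submission
  imports Defs "Berlekamp_Zassenhaus.Factor_Bound"
begin

text \<open>
  If the simultaneous approximation system with exponent \<open>\<mu>\<close> has no solution at \<open>X\<close>, then the
  lattice of integer polynomials of degree at most \<open>n\<close>, with \<open>P \<zeta>\<close> measured in units of \<open>1 / X\<close>
  and the higher coefficients in units of \<open>X powr \<mu>\<close>, has bounded covering radius, because the
  nonzero vectors of its dual are long.  Hence some integer polynomial \<open>P\<close> lies within bounded
  distance of \<open>M * X powr \<mu> * (T - \<zeta>)\<close>.  For a large constant \<open>M\<close> its slope near \<open>\<zeta>\<close> is at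
  least \<open>X powr \<mu>\<close> while \<open>P \<zeta>\<close> is of order \<open>1 / X\<close>, so \<open>P\<close> has a real root \<open>\<alpha>\<close> at distance of
  order \<open>X powr (- 1 - \<mu>)\<close> from \<open>\<zeta>\<close>.  By the Mignotte bound \<open>H \<alpha>\<close> is of order at most
  \<open>X powr \<mu>\<close>, which gives approximation exponent \<open>1 / \<mu>\<close>.
\<close>

hide_const (open) up_ring.coeff up_ring.monom module.smult

section \<open>Integer minimal polynomials and the height \<open>H\<close>\<close>

lemma abs_coeff_le_poly_height: "\<bar>coeff p i\<bar> \<le> poly_height p"
proof (cases "i \<le> degree p")
  case True
  thus ?thesis unfolding poly_height_def by (intro Max_ge) auto
next
  case False
  have "0 \<le> \<bar>coeff p 0\<bar>" by simp
  also have "\<dots> \<le> poly_height p" unfolding poly_height_def by (intro Max_ge) auto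
  finally show ?thesis using False by (simp add: coeff_eq_0)
qed

lemma poly_height_leI: "(\<And>i. i \<le> degree p \<Longrightarrow> \<bar>coeff p i\<bar> \<le> h) \<Longrightarrow> poly_height p \<le> h"
  unfolding poly_height_def by (subst Max_le_iff) auto

lemma int_minpoly_exists:
  assumes "int_root P \<alpha>"
  obtains p where "int_minpoly \<alpha> p"
proof -
  obtain q where q: "int_root q \<alpha>" and min: "\<And>r. int_root r \<alpha> \<Longrightarrow> degree q \<le> degree r"
    using ex_has_least_nat[of "\<lambda>q. int_root q \<alpha>" P degree] assms by blast
  have q0: "q \<noteq> 0" using q by (simp add: int_root_def)
  have "of_int_poly q = smult (of_int (content q)) (of_int_poly (primitive_part q) :: real poly)"
    by (subst content_times_primitive_part[of q, symmetric]) (simp only: of_int_hom.map_poly_hom_smult)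
  hence "int_root (primitive_part q) \<alpha>"
    using q q0 by (auto simp: int_root_def)
  hence "int_minpoly \<alpha> (primitive_part q)"
    using q0 min by (simp add: int_minpoly_def content_primitive_part)
  thus ?thesis by (rule that)
qed

text \<open>Pseudo-division by \<open>p\<close> leaves a remainder of smaller degree that vanishes
  at \<alpha>, hence is zero by minimality. Since \<open>content p = 1\<close>, Gauss's lemma places
  the multiplier \<open>c\<close> entirely in the quotient.\<close>

lemma int_minpoly_dvd:
  assumes p: "int_minpoly \<alpha> p" and P: "int_root P \<alpha>"
  shows "p dvd P"
proof -
  have p0: "p \<noteq> 0" and root: "poly (of_int_poly p) \<alpha> = 0" and cont: "content p = 1"
    using p by (auto simp: int_minpoly_def int_root_def)
  obtain q r where qr: "pseudo_divmod P p = (q, r)" by force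
  obtain c where c: "c \<noteq> 0" "smult c P = p * q + r"
    by (rule that[OF _ pseudo_divmod(1)[OF p0 qr]]) (use p0 in simp)
  have "poly (of_int_poly (smult c P)) \<alpha> = poly (of_int_poly (p * q + r)) \<alpha>"
    by (simp only: c)
  hence "poly (of_int_poly r) \<alpha> = 0"
    using P root by (simp add: int_root_def hom_distribs)
  moreover have "r = 0 \<or> degree r < degree p" by (rule pseudo_divmod(2)[OF p0 qr])
  ultimately have "r = 0"
    using p unfolding int_minpoly_def int_root_def by (metis not_le)
  hence eq: "p * q = smult c P" using c by simp
  have "content q = content (p * q)" by (simp add: content_mult cont)
  hence "[:c:] dvd q" unfolding eq const_poly_dvd_iff_dvd_content by simp
  then obtain q' where "q = smult c q'" by (auto simp: dvd_def)
  hence "smult c (p * q') = smult c P" using eq by simp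
  hence "p * q' = P" using c(1) by (simp add: poly_eq_iff)
  thus ?thesis by (rule dvdI[OF sym])
qed

lemma int_minpoly_unique:
  assumes "int_minpoly \<alpha> p" "int_minpoly \<alpha> q"
  shows "q = p \<or> q = - p"
proof -
  have pq: "p dvd q" "q dvd p" and p0: "p \<noteq> 0"
    using assms int_minpoly_dvd by (auto simp: int_minpoly_def int_root_def)
  obtain k where k: "q = p * k" using pq(1) ..
  obtain l where l: "p = q * l" using pq(2) ..
  have "p * (k * l) = p * 1" using k l by (metis mult.assoc mult.right_neutral)
  hence "k * l = 1" using p0 by simp
  hence "is_unit k" by (metis dvd_triv_left)
  then obtain c where "k = [:c:]" "is_unit c" using is_unit_poly_iff by blast
  thus ?thesis unfolding k by (auto simp: zdvd1_eq abs_if split: if_splits)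
qed

text \<open>The sign ambiguity of the minimal polynomial does not affect absolute values, so the
  \<open>THE\<close> in \<open>H\<close> is well defined.\<close>

lemma H_eq:
  assumes "int_minpoly \<alpha> p"
  shows "H \<alpha> = real_of_int (poly_height p)"
  unfolding H_def
proof (rule the_equality)
  fix h assume "\<exists>q. int_minpoly \<alpha> q \<and> h = real_of_int (poly_height q)"
  then obtain q where q: "int_minpoly \<alpha> q" "h = real_of_int (poly_height q)" by blast
  have "poly_height q = poly_height p"
    using int_minpoly_unique[OF assms q(1)] by (auto simp: poly_height_def)
  thus "h = real_of_int (poly_height p)" using q by simp
qed (use assms in blast)

lemma mahler_measure_le_poly_height:
  assumes "degree P \<le> n"
  shows "mahler_measure P \<le> real (Suc n) * poly_height P"
proof -
  have h: "0 \<le> poly_height P" using abs_coeff_le_poly_height[of P 0] by simp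
  have "(\<Sum>a\<leftarrow>coeffs P. a * a) \<le> (\<Sum>a\<leftarrow>coeffs P. (poly_height P)\<^sup>2)"
  proof (rule sum_list_mono)
    fix a assume "a \<in> set (coeffs P)"
    then obtain i where "a = coeff P i" by (auto simp: coeffs_def split: if_splits)
    hence "\<bar>a\<bar> \<le> \<bar>poly_height P\<bar>" using abs_coeff_le_poly_height[of P i] by simp
    thus "a * a \<le> (poly_height P)\<^sup>2" unfolding power2_eq_square[symmetric] by (rule abs_le_square_iff[THEN iffD1])
  qed
  also have "\<dots> = int (length (coeffs P)) * (poly_height P)\<^sup>2" by (simp add: sum_list_triv)
  also have "\<dots> \<le> int (Suc n) * (poly_height P)\<^sup>2"
    using assms by (intro mult_right_mono) (auto simp: length_coeffs_degree coeffs_def)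
  \<comment> \<open>The wasteful factor makes the bound a perfect square.\<close>
  also have "\<dots> \<le> (int (Suc n))\<^sup>2 * (poly_height P)\<^sup>2"
    by (intro mult_right_mono) (auto simp: power2_eq_square)
  finally have "(\<Sum>a\<leftarrow>coeffs P. a * a) \<le> (int (Suc n) * poly_height P)\<^sup>2"
    by (simp only: power_mult_distrib)
  hence "real_of_int (\<Sum>a\<leftarrow>coeffs P. a * a) \<le> of_int ((int (Suc n) * poly_height P)\<^sup>2)"
    by (simp only: of_int_le_iff)
  also have "\<dots> = (real (Suc n) * poly_height P)\<^sup>2"
    by (simp only: of_int_power of_int_mult of_int_of_nat_eq)
  finally have "real_of_int (\<Sum>a\<leftarrow>coeffs P. a * a) \<le> (real (Suc n) * poly_height P)\<^sup>2" .
  hence "sqrt (real_of_int (\<Sum>a\<leftarrow>coeffs P. a * a)) \<le> real (Suc n) * poly_height P"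
    using h by (intro real_le_lsqrt) (auto intro!: mult_nonneg_nonneg)
  thus ?thesis using Landau_inequality_mahler_measure[of P] by linarith
qed

text \<open>\<open>P\<close> may be reducible. The minimal polynomial divides it and so has no
  larger Mahler measure, and the Mignotte bound turns this back into a bound on
  coefficients.\<close>

lemma H_bounds:
  assumes P: "int_root P \<alpha>" and deg: "degree P \<le> n"
  shows "1 \<le> H \<alpha>" "H \<alpha> \<le> 2 ^ n * real (Suc n) * poly_height P"
proof -
  obtain p where p: "int_minpoly \<alpha> p" by (rule int_minpoly_exists[OF P])
  have p0: "p \<noteq> 0" and P0: "P \<noteq> 0"
    using p P by (auto simp: int_minpoly_def int_root_def)
  have pP: "p dvd P" by (rule int_minpoly_dvd[OF p P])
  have deg_p: "degree p \<le> n" using dvd_imp_degree_le[OF pP P0] deg by simp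
  have "1 \<le> \<bar>lead_coeff p\<bar>" using p0 by (smt (verit) leading_coeff_0_iff)
  also have "\<dots> \<le> poly_height p" by (rule abs_coeff_le_poly_height)
  finally show "1 \<le> H \<alpha>" by (simp add: H_eq[OF p])
  have "\<bar>coeff p i\<bar> \<le> \<lfloor>2 ^ n * (real (Suc n) * poly_height P)\<rfloor>" for i
  proof -
    have "real_of_int \<bar>coeff p i\<bar> \<le> (degree p choose i) * mahler_measure p"
      by (rule Mignotte_bound)
    also have "\<dots> \<le> 2 ^ n * (real (Suc n) * poly_height P)"
    proof (rule mult_mono)
      have "degree p choose i \<le> 2 ^ degree p" by (rule binomial_le_pow2)
      also have "\<dots> \<le> 2 ^ n" using deg_p by simp
      finally have "real (degree p choose i) \<le> real (2 ^ n)" by (simp only: of_nat_le_iff)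
      thus "real (degree p choose i) \<le> 2 ^ n" by simp
      show "mahler_measure p \<le> real (Suc n) * real_of_int (poly_height P)"
        using mahler_measure_dvd[OF P0 pP] mahler_measure_le_poly_height[OF deg] by linarith
    qed (auto simp: mahler_measure_ge_0)
    finally show ?thesis by linarith
  qed
  hence "poly_height p \<le> \<lfloor>2 ^ n * (real (Suc n) * poly_height P)\<rfloor>" by (rule poly_height_leI)
  thus "H \<alpha> \<le> 2 ^ n * real (Suc n) * poly_height P" by (simp add: H_eq[OF p] le_floor_iff mult.assoc)
qed

section \<open>Reflections and transference for lattices\<close>

text \<open>One identity encodes integer linearity: \<open>u = v\<close>, \<open>k = 1\<close> gives
  the value 0 at 0. Its shape fits the reduction of \<open>v\<close> modulo
  \<open>u\<close>.\<close>

definition int_linear :: "((nat \<Rightarrow> int) \<Rightarrow> real) \<Rightarrow> bool" where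
  "int_linear g \<longleftrightarrow> (\<forall>v u k. g (\<lambda>j. v j - k * u j) = g v - of_int k * g u)"

lemma int_linearD: "int_linear g \<Longrightarrow> g (\<lambda>j. v j - k * u j) = g v - of_int k * g u"
  by (simp add: int_linear_def)

text \<open>The Householder reflection along the difference of \<open>a\<close> and the vector of
  the same length on axis \<open>d\<close> exchanges these two.\<close>

lemma reflection_to_axis:
  fixes a :: "nat \<Rightarrow> real"
  assumes "(\<Sum>i\<le>d. (a i)\<^sup>2) \<noteq> 0"
  obtains Q :: "(nat \<Rightarrow> real) \<Rightarrow> nat \<Rightarrow> real" and r where
    "r > 0" "r\<^sup>2 = (\<Sum>i\<le>d. (a i)\<^sup>2)"
    "\<And>x y c i. Q (\<lambda>j. x j - c * y j) i = Q x i - c * Q y i"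
    "\<And>x y. (\<Sum>i\<le>d. Q x i * y i) = (\<Sum>i\<le>d. x i * Q y i)"
    "\<And>x. (\<Sum>i\<le>d. (Q x i)\<^sup>2) = (\<Sum>i\<le>d. (x i)\<^sup>2)"
    "Q a d = r" "\<And>i. i < d \<Longrightarrow> Q a i = 0"
proof -
  define r where "r = sqrt (\<Sum>i\<le>d. (a i)\<^sup>2)"
  have pos: "(\<Sum>i\<le>d. (a i)\<^sup>2) > 0"
    using assms sum_nonneg[of "{..d}" "\<lambda>i. (a i)\<^sup>2"] by simp
  have r: "r > 0" and r2: "r\<^sup>2 = (\<Sum>i\<le>d. (a i)\<^sup>2)"
    using pos by (auto simp: r_def)
  \<comment> \<open>\<open>h = 0\<close> is allowed: then \<open>s x = 0\<close> by the convention \<open>x / 0 = 0\<close>, and \<open>Q\<close> is the identity.\<close>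
  define h where "h i = a i - (if i = d then r else 0)" for i
  define N where "N = (\<Sum>i\<le>d. (h i)\<^sup>2)"
  define s where "s x = 2 * (\<Sum>i\<le>d. h i * x i) / N" for x :: "nat \<Rightarrow> real"
  define Q where "Q x i = x i - s x * h i" for x i
  have s_lin: "s (\<lambda>j. x j - c * y j) = s x - c * s y" for x y c
    by (simp add: s_def sum_subtractf sum_distrib_left right_diff_distrib diff_divide_distrib mult_ac)
  have sN: "s x * N = 2 * (\<Sum>i\<le>d. h i * x i)" for x
  proof (cases "N = 0")
    case True
    hence "h i = 0" if "i \<le> d" for i
      using that unfolding N_def by (subst (asm) sum_nonneg_eq_0_iff) auto
    thus ?thesis using True by simp
  qed (simp add: s_def)
  have lin: "Q (\<lambda>j. x j - c * y j) i = Q x i - c * Q y i" for x y c i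
    by (simp add: Q_def s_lin algebra_simps)
  have "(\<Sum>i\<le>d. Q x i * y i) = (\<Sum>i\<le>d. x i * y i) - s x * (\<Sum>i\<le>d. h i * y i)" for x y
    by (simp add: Q_def algebra_simps sum_subtractf sum_distrib_left)
  hence Qy: "(\<Sum>i\<le>d. Q x i * y i) = (\<Sum>i\<le>d. x i * y i) - s x * s y * N / 2" for x y
    using sN[of y] by (simp add: mult.assoc)
  have adj: "(\<Sum>i\<le>d. Q x i * y i) = (\<Sum>i\<le>d. x i * Q y i)" for x y
    using Qy[of x y] Qy[of y x] by (simp add: mult_ac)
  have norm: "(\<Sum>i\<le>d. (Q x i)\<^sup>2) = (\<Sum>i\<le>d. (x i)\<^sup>2)" for x
  proof -
    have "(\<Sum>i\<le>d. (Q x i)\<^sup>2) = (\<Sum>i\<le>d. (x i)\<^sup>2) - 2 * s x * (\<Sum>i\<le>d. h i * x i) + (s x)\<^sup>2 * N"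
      by (simp add: Q_def N_def power2_diff sum.distrib sum_subtractf sum_distrib_left
          power_mult_distrib mult_ac)
    also have "\<dots> = (\<Sum>i\<le>d. (x i)\<^sup>2)"
      using sN[of x] by (simp add: power2_eq_square algebra_simps)
    finally show ?thesis .
  qed
  have ha: "(\<Sum>i\<le>d. h i * a i) = r\<^sup>2 - r * a d"
    using r2 by (simp add: h_def left_diff_distrib sum_subtractf power2_eq_square if_distrib[of "\<lambda>x. x * _"]
        cong: if_cong)
  \<comment> \<open>As \<open>a\<close> has length \<open>r\<close>, \<open>N\<close> is twice the
    inner product of \<open>h\<close> and \<open>a\<close>. So \<open>s a = 1\<close> unless
    \<open>N = 0\<close>, and \<open>Q a\<close> is \<open>a - h\<close>.\<close>
  have "N = (\<Sum>i\<le>d. h i * a i) - (\<Sum>i\<le>d. h i * (if i = d then r else 0))"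
    by (simp add: N_def power2_eq_square right_diff_distrib sum_subtractf[symmetric] h_def)
  also have "(\<Sum>i\<le>d. h i * (if i = d then r else 0)) = (a d - r) * r"
    by (simp add: h_def if_distrib[of "\<lambda>x. _ * x"] cong: if_cong)
  finally have N: "N = 2 * (\<Sum>i\<le>d. h i * a i)"
    using ha by (simp add: power2_eq_square algebra_simps)
  have Qa: "Q a i = (if i = d then r else 0)" if "i \<le> d" for i
  proof (cases "N = 0")
    case True
    hence "h i = 0"
      using that unfolding N_def by (subst (asm) sum_nonneg_eq_0_iff) auto
    thus ?thesis by (simp add: Q_def h_def split: if_splits)
  next
    case False
    hence "s a = 1" using N by (simp add: s_def)
    thus ?thesis by (simp add: Q_def h_def)
  qed
  show ?thesis
    by (rule that[of r Q]) (use r r2 lin adj norm Qa in auto)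
qed

text \<open>
  This bounds, up to a constant depending on the rank, the covering radius of a lattice by the
  reciprocal of the minimum of the dual lattice.  The forms \<open>e i\<close> embed the dual lattice, \<open>f\<close> is an arbitrary real functional on it, and \<open>w\<close> is the correction making \<open>f\<close>
  integral.  After rotating an almost shortest vector \<open>u\<close> onto the last axis, the last coordinate of
  \<open>w\<close> makes \<open>f u\<close> integral and the first \<open>d\<close> coordinates are obtained by recursion; the projected
  vectors stay long because each of them lifts to a vector whose component along \<open>u\<close> is at most
  half of \<open>u\<close>.
\<close>

lemma transference:
  fixes e :: "nat \<Rightarrow> (nat \<Rightarrow> int) \<Rightarrow> real" and f :: "(nat \<Rightarrow> int) \<Rightarrow> real"
  assumes "\<And>i. int_linear (e i)" and "int_linear f" and "D > 0"
    and "\<And>v. (\<Sum>i<d. (e i v)\<^sup>2) = 0 \<Longrightarrow> f v \<in> \<int>"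
    and "\<And>v. (\<Sum>i<d. (e i v)\<^sup>2) \<noteq> 0 \<Longrightarrow> D \<le> (\<Sum>i<d. (e i v)\<^sup>2)"
  shows "\<exists>w. (\<Sum>i<d. (w i)\<^sup>2) \<le> 4 ^ d / D \<and> (\<forall>v. f v + (\<Sum>i<d. w i * e i v) \<in> \<int>)"
  using assms
proof (induction d arbitrary: e f D)
  case 0
  thus ?case by auto
next
  case (Suc d)
  note f_lin = int_linearD[OF Suc.prems(2)] and D = Suc.prems(3)
  define B where "B v = (\<Sum>i\<le>d. (e i v)\<^sup>2)" for v
  have B_zero: "f v \<in> \<int>" if "B v = 0" for v
    using Suc.prems(4)[of v] that by (simp add: B_def lessThan_Suc_atMost)
  have B_ge: "D \<le> B v" if "B v \<noteq> 0" for v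
    using Suc.prems(5)[of v] that by (simp add: B_def lessThan_Suc_atMost)
  have goal: "?case \<longleftrightarrow>
    (\<exists>w. (\<Sum>i\<le>d. (w i)\<^sup>2) \<le> 4 ^ Suc d / D \<and> (\<forall>v. f v + (\<Sum>i\<le>d. w i * e i v) \<in> \<int>))"
    by (simp only: lessThan_Suc_atMost)
  show ?case
  proof (cases "\<exists>v. B v \<noteq> 0")
    case False
    thus ?thesis unfolding goal
      using B_zero D by (intro exI[of _ "\<lambda>_. 0"]) auto
  next
    case True
    define I where "I = Inf (B ` {v. B v \<noteq> 0})"
    have bdd: "bdd_below (B ` {v. B v \<noteq> 0})"
      using B_ge by (intro bdd_belowI[of _ D]) auto
    have "D \<le> I" unfolding I_def
      by (rule cInf_greatest) (use True B_ge in auto)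
    \<comment> \<open>The slack 4/3 provides \<open>u\<close> without showing that the infimum is
      attained. Every nonzero \<open>B v\<close> is then at least 3/4 of \<open>B u\<close>, against
      a loss of at most 1/4 of \<open>B u\<close> by rounding.\<close>
    hence "I < 4 / 3 * I" using D by simp
    hence "\<exists>z\<in>B ` {v. B v \<noteq> 0}. z < 4 / 3 * I"
      using True by (intro cInf_lessD) (auto simp: I_def)
    then obtain u where u: "B u \<noteq> 0" "B u < 4 / 3 * I" by auto
    have u_min: "3 / 4 * B u \<le> B v" if "B v \<noteq> 0" for v
    proof -
      have "I \<le> B v" unfolding I_def by (rule cInf_lower) (use bdd that in auto)
      thus ?thesis using u(2) by simp
    qed
    have nz: "(\<Sum>i\<le>d. (e i u)\<^sup>2) \<noteq> 0" using u(1) by (simp add: B_def)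
    obtain Q r where r: "r > 0" "r\<^sup>2 = (\<Sum>i\<le>d. (e i u)\<^sup>2)"
      and Q_lin: "\<And>x y c i. Q (\<lambda>j. x j - c * y j) i = Q x i - c * Q y i"
      and Q_adj: "\<And>x y. (\<Sum>i\<le>d. Q x i * y i) = (\<Sum>i\<le>d. x i * Q y i)"
      and Q_norm: "\<And>x. (\<Sum>i\<le>d. (Q x i)\<^sup>2) = (\<Sum>i\<le>d. (x i)\<^sup>2)"
      and Qu: "Q (\<lambda>i. e i u) d = r" "\<And>i. i < d \<Longrightarrow> Q (\<lambda>i. e i u) i = 0"
      by (rule reflection_to_axis[OF nz], rule that)
    have r: "r > 0" "r\<^sup>2 = B u" using r by (simp_all add: B_def)
    define e' where "e' i v = Q (\<lambda>j. e j v) i" for i v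
    have e'_lin: "int_linear (e' i)" for i
      unfolding int_linear_def e'_def int_linearD[OF Suc.prems(1)] by (simp add: Q_lin)
    have e'_u: "e' d u = r" "\<And>i. i < d \<Longrightarrow> e' i u = 0"
      using Qu by (auto simp: e'_def)
    have B_split: "B v = (\<Sum>i<d. (e' i v)\<^sup>2) + (e' d v)\<^sup>2" for v
      using Q_norm[of "\<lambda>i. e i v"] unfolding B_def e'_def
      by (simp add: lessThan_Suc_atMost[symmetric])
    \<comment> \<open>Since \<open>e' d u = r\<close>, adding \<open>s / r\<close> times the last
      form moves \<open>f u\<close> to the nearest integer.\<close>
    define s where "s = of_int (round (f u)) - f u"
    have s: "\<bar>s\<bar> \<le> 1 / 2" unfolding s_def using of_int_round_abs_le by blast
    define f' where "f' v = f v + s / r * e' d v" for v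
    have f'_lin: "int_linear f'"
      unfolding int_linear_def f'_def f_lin int_linearD[OF e'_lin] by (simp add: algebra_simps)
    have f'_u: "f' u \<in> \<int>" using r by (simp add: f'_def e'_u s_def)
    have dich: "f' v \<in> \<int> \<and> (\<Sum>i<d. (e' i v)\<^sup>2) = 0 \<or> D / 2 \<le> (\<Sum>i<d. (e' i v)\<^sup>2)" for v
    proof -
      \<comment> \<open>Subtracting \<open>k\<close> times \<open>u\<close> keeps the first
        \<open>d\<close> rotated coordinates and brings the last one down to at most
        \<open>r / 2\<close>.\<close>
      define k where "k = round (e' d v / r)"
      define v0 where "v0 = (\<lambda>j. v j - k * u j)"
      have e'_v0: "e' i v0 = e' i v - of_int k * e' i u" for i
        unfolding v0_def by (rule int_linearD[OF e'_lin])
      have "e' d v0 = - ((of_int k - e' d v / r) * r)"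
        using r by (simp add: e'_v0 e'_u left_diff_distrib)
      hence "\<bar>e' d v0\<bar> = \<bar>of_int k - e' d v / r\<bar> * r"
        using r by (simp only: abs_minus_cancel abs_mult abs_of_pos)
      also have "\<dots> \<le> 1 / 2 * r"
        unfolding k_def by (intro mult_right_mono of_int_round_abs_le) (use r in auto)
      finally have "(e' d v0)\<^sup>2 \<le> (1 / 2 * r)\<^sup>2" using r by (intro abs_le_square_iff[THEN iffD1]) simp
      hence last: "(e' d v0)\<^sup>2 \<le> B u / 4" by (simp add: power_divide r(2))
      have Bv0: "B v0 = (\<Sum>i<d. (e' i v)\<^sup>2) + (e' d v0)\<^sup>2"
        unfolding B_split by (simp add: e'_v0 e'_u)
      show ?thesis
      proof (cases "B v0 = 0")
        case True
        have nn: "(\<Sum>i<d. (e' i v)\<^sup>2) \<ge> 0" by (intro sum_nonneg) auto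
        with True Bv0 have z: "(\<Sum>i<d. (e' i v)\<^sup>2) = 0" "e' d v0 = 0"
          by (auto simp: add_nonneg_eq_0_iff)
        have "f' v0 \<in> \<int>" using B_zero[OF True] z by (simp add: f'_def)
        moreover have "f' v0 = f' v - of_int k * f' u"
          unfolding v0_def by (rule int_linearD[OF f'_lin])
        ultimately have "f' v0 + of_int k * f' u \<in> \<int>" "f' v0 + of_int k * f' u = f' v"
          using f'_u by (auto intro!: Ints_add Ints_mult)
        thus ?thesis using z by simp
      next
        case False
        \<comment> \<open>What remains is at least 3/4 - 1/4 = 1/2 of \<open>B u\<close>, hence at
          least \<open>D / 2\<close>.\<close>
        thus ?thesis using u_min[OF False] last Bv0 B_ge[OF u(1)] by simp
      qed
    qed
    have "\<exists>w. (\<Sum>i<d. (w i)\<^sup>2) \<le> 4 ^ d / (D / 2) \<and> (\<forall>v. f' v + (\<Sum>i<d. w i * e' i v) \<in> \<int>)"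
    proof (rule Suc.IH)
      show "f' v \<in> \<int>" if "(\<Sum>i<d. (e' i v)\<^sup>2) = 0" for v
        using dich[of v] that D by auto
      show "D / 2 \<le> (\<Sum>i<d. (e' i v)\<^sup>2)" if "(\<Sum>i<d. (e' i v)\<^sup>2) \<noteq> 0" for v
        using dich[of v] that by auto
    qed (use e'_lin f'_lin D in auto)
    then obtain w where w: "(\<Sum>i<d. (w i)\<^sup>2) \<le> 4 ^ d / (D / 2)"
      "\<And>v. f' v + (\<Sum>i<d. w i * e' i v) \<in> \<int>" by blast
    \<comment> \<open>The correction in rotated coordinates; as \<open>Q\<close> is self-adjoint,
      \<open>Q w'\<close> corrects with respect to the original forms.\<close>
    define w' where "w' i = (if i = d then s / r else w i)" for i
    have sum_w': "(\<Sum>i\<le>d. g (w' i) i) = (\<Sum>i<d. g (w i) i) + g (s / r) d" for g :: "real \<Rightarrow> nat \<Rightarrow> real"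
      by (simp add: w'_def lessThan_Suc_atMost[symmetric])
    have "(\<Sum>i\<le>d. (Q w' i)\<^sup>2) = (\<Sum>i<d. (w i)\<^sup>2) + (s / r)\<^sup>2"
      unfolding Q_norm using sum_w'[of "\<lambda>x _. x\<^sup>2"] by simp
    also have "(s / r)\<^sup>2 \<le> (1 / 4) / D"
    proof -
      have "s\<^sup>2 \<le> (1 / 2)\<^sup>2" using s by (intro abs_le_square_iff[THEN iffD1]) simp
      hence "s\<^sup>2 \<le> 1 / 4" by (simp add: power2_eq_square)
      thus ?thesis unfolding power_divide r(2)
        using B_ge[OF u(1)] D by (intro frac_le) auto
    qed
    also have "(\<Sum>i<d. (w i)\<^sup>2) \<le> 4 ^ d / (D / 2)" by (rule w(1))
    also have "4 ^ d / (D / 2) + (1 / 4) / D = (2 * 4 ^ d + 1 / 4) / D"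
      by (simp add: add_divide_distrib)
    \<comment> \<open>Halving \<open>D\<close> doubles the recursive bound, and the factor 4 per
      dimension leaves room for the extra 1/4.\<close>
    also have "\<dots> \<le> 4 ^ Suc d / D"
    proof (rule divide_right_mono)
      have "(1::real) \<le> 4 ^ d" by simp
      thus "2 * 4 ^ d + 1 / 4 \<le> (4::real) ^ Suc d" unfolding power_Suc by linarith
    qed (use D in simp)
    finally have "(\<Sum>i\<le>d. (Q w' i)\<^sup>2) \<le> 4 ^ Suc d / D" by simp
    moreover have "f v + (\<Sum>i\<le>d. Q w' i * e i v) \<in> \<int>" for v
    proof -
      have "(\<Sum>i\<le>d. Q w' i * e i v) = (\<Sum>i\<le>d. w' i * e' i v)"
        unfolding e'_def by (rule Q_adj)
      also have "\<dots> = (\<Sum>i<d. w i * e' i v) + s / r * e' d v"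
        using sum_w'[of "\<lambda>x i. x * e' i v"] by simp
      finally show ?thesis using w(2)[of v] by (simp add: f'_def add_ac)
    qed
    ultimately show ?thesis unfolding goal by blast
  qed
qed

section \<open>Integer polynomials near a real target\<close>

lemma sum_atMost_split_0:
  fixes g :: "nat \<Rightarrow> 'a::comm_monoid_add"
  shows "(\<Sum>k\<le>n. g k) = g 0 + (\<Sum>k=1..n. g k)"
  by (simp add: atMost_atLeast0 sum.atLeast_Suc_atMost)

lemma poly_of_int_eq_sum:
  assumes "degree P \<le> n"
  shows "poly (map_poly real_of_int P) x = (\<Sum>i\<le>n. of_int (coeff P i) * x ^ i)"
proof -
  have "degree (map_poly real_of_int P) \<le> n"
    by (rule degree_le) (use assms in \<open>auto simp: coeff_map_poly coeff_eq_0\<close>)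
  hence "poly (map_poly real_of_int P) x = (\<Sum>i\<le>n. coeff (map_poly real_of_int P) i * x ^ i)"
    unfolding poly_altdef by (intro sum.mono_neutral_left) (auto simp: coeff_eq_0)
  thus ?thesis by (simp add: coeff_map_poly)
qed

text \<open>\<open>r\<close> lists the coefficients of a target vanishing at \<zeta>. A nonzero dual
  vector of length below 1 would solve the system, so \<open>transference\<close> applies with
  \<open>D = 1\<close> in dimension \<open>Suc n\<close>; the square root of its bound
  \<open>4 ^ Suc n\<close> limits each coordinate.\<close>

lemma poly_near_target_if_not_sim_sys:
  fixes r :: "nat \<Rightarrow> real"
  assumes "X > 0" and fails: "\<not> sim_sys n \<zeta> \<mu> X"
    and r: "(\<Sum>i\<le>n. r i * \<zeta> ^ i) = 0"
  obtains P :: "int poly" where "degree P \<le> n"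
    "\<bar>poly (map_poly real_of_int P) \<zeta>\<bar> \<le> 2 ^ Suc n / X"
    "\<And>i. i \<in> {1..n} \<Longrightarrow> \<bar>of_int (coeff P i) - r i\<bar> \<le> 2 ^ Suc n * X powr \<mu>"
proof -
  define Y where "Y = X powr \<mu>"
  have Y: "Y > 0" and Y_inv: "X powr (- \<mu>) = 1 / Y"
    using \<open>X > 0\<close> by (auto simp: Y_def powr_minus_divide)
  \<comment> \<open>With \<open>v 0\<close> as \<open>x\<close> and \<open>v i\<close> as
    \<open>y i\<close>, the inequalities of the system say that every \<open>e i v\<close> is at
    most 1 in absolute value.\<close>
  define e :: "nat \<Rightarrow> (nat \<Rightarrow> int) \<Rightarrow> real" where
    "e i v = (if i = 0 then v 0 / X else Y * (\<zeta> ^ i * v 0 - v i))" for i v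
  define f :: "(nat \<Rightarrow> int) \<Rightarrow> real" where "f v = (\<Sum>i\<le>n. r i * v i)" for v
  have e_lin: "int_linear (e i)" for i
    unfolding int_linear_def e_def by (auto simp: algebra_simps diff_divide_distrib)
  have f_lin: "int_linear f"
    unfolding int_linear_def f_def by (simp add: algebra_simps sum_subtractf sum_distrib_left)
  have zero: "v i = 0" if "(\<Sum>i<Suc n. (e i v)\<^sup>2) = 0" "i \<le> n" for v i
  proof -
    have z: "e i v = 0" if "i \<le> n" for i
      using \<open>(\<Sum>i<Suc n. (e i v)\<^sup>2) = 0\<close> that
      by (subst (asm) sum_nonneg_eq_0_iff) (auto simp: less_Suc_eq_le)
    have "v 0 = 0" using z[of 0] \<open>X > 0\<close> by (simp add: e_def)
    thus ?thesis using z[OF that(2)] Y by (cases "i = 0") (auto simp: e_def)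
  qed
  have ge: "1 \<le> (\<Sum>i<Suc n. (e i v)\<^sup>2)" if nz: "(\<Sum>i<Suc n. (e i v)\<^sup>2) \<noteq> 0" for v
  proof (rule ccontr)
    assume "\<not> ?thesis"
    hence small: "(\<Sum>i<Suc n. (e i v)\<^sup>2) \<le> 1" by simp
    have e_le: "\<bar>e i v\<bar> \<le> 1" if "i \<le> n" for i
    proof -
      have "(e i v)\<^sup>2 \<le> (\<Sum>i<Suc n. (e i v)\<^sup>2)"
        by (rule member_le_sum) (use that in auto)
      thus ?thesis using small by (simp add: abs_square_le_1[symmetric])
    qed
    have "v 0 \<noteq> 0 \<or> (\<exists>i\<in>{1..n}. v i \<noteq> 0)"
    proof (rule ccontr)
      assume "\<not> ?thesis"
      hence "v i = 0" if "i \<le> n" for i using that by (cases "i = 0") auto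
      hence "e i v = 0" if "i \<le> n" for i using that by (simp add: e_def)
      thus False using nz by simp
    qed
    moreover have "\<bar>real_of_int (v 0)\<bar> \<le> X"
      using e_le[of 0] \<open>X > 0\<close> by (simp add: e_def field_simps)
    moreover have "\<bar>\<zeta> ^ i * v 0 - v i\<bar> \<le> X powr (- \<mu>)" if "i \<in> {1..n}" for i
    proof -
      have "Y * \<bar>\<zeta> ^ i * v 0 - v i\<bar> \<le> 1"
        using e_le[of i] that Y by (simp add: e_def abs_mult)
      thus ?thesis using Y by (simp add: Y_inv pos_le_divide_eq mult.commute)
    qed
    ultimately have "sim_sys n \<zeta> \<mu> X" unfolding sim_sys_def by blast
    thus False using fails by blast
  qed
  have "\<exists>w. (\<Sum>i<Suc n. (w i)\<^sup>2) \<le> 4 ^ Suc n / 1 \<and> (\<forall>v. f v + (\<Sum>i<Suc n. w i * e i v) \<in> \<int>)"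
  proof (rule transference)
    show "f v \<in> \<int>" if "(\<Sum>i<Suc n. (e i v)\<^sup>2) = 0" for v
      using zero[OF that] by (simp add: f_def)
  qed (use e_lin f_lin ge in simp_all)
  then obtain w where w: "(\<Sum>i<Suc n. (w i)\<^sup>2) \<le> 4 ^ Suc n"
    and int: "\<And>v. f v + (\<Sum>i<Suc n. w i * e i v) \<in> \<int>" by auto
  have w_le: "\<bar>w i\<bar> \<le> 2 ^ Suc n" if "i \<le> n" for i
  proof -
    have "(w i)\<^sup>2 \<le> (\<Sum>i<Suc n. (w i)\<^sup>2)"
      by (rule member_le_sum) (use that in auto)
    also note w
    also have "4 ^ Suc n = ((2::real) ^ Suc n)\<^sup>2"
      by (simp add: power2_eq_square flip: power_mult_distrib)
    finally have "\<bar>w i\<bar> \<le> \<bar>2 ^ Suc n\<bar>" by (simp only: abs_le_square_iff)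
    thus ?thesis by simp
  qed
  \<comment> \<open>The values of the corrected, integral functional on the unit vectors become the
    coefficients of \<open>P\<close>.\<close>
  define unit where "unit k = (\<lambda>j. if j = k then 1 else (0::int))" for k :: nat
  define a where "a k = \<lfloor>f (unit k) + (\<Sum>i<Suc n. w i * e i (unit k))\<rfloor>" for k
  have a: "of_int (a k) = f (unit k) + (\<Sum>i<Suc n. w i * e i (unit k))" for k
  proof -
    obtain z where "f (unit k) + (\<Sum>i<Suc n. w i * e i (unit k)) = of_int z"
      using int by (rule Ints_cases)
    thus ?thesis by (simp only: a_def floor_of_int)
  qed
  have f_unit: "f (unit k) = r k" if "k \<le> n" for k
    using that by (simp add: f_def unit_def if_distrib[of real_of_int] if_distrib[of "\<lambda>x. _ * x"] cong: if_cong)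
  have a_pos: "of_int (a k) = r k - w k * Y" if "k \<in> {1..n}" for k
  proof -
    have "(\<Sum>i<Suc n. w i * e i (unit k)) = (\<Sum>i<Suc n. if i = k then - (w k * Y) else 0)"
      by (rule sum.cong) (use that in \<open>auto simp: e_def unit_def\<close>)
    thus ?thesis using that by (simp add: a f_unit)
  qed
  have a_0: "of_int (a 0) = r 0 + w 0 / X + (\<Sum>i=1..n. w i * Y * \<zeta> ^ i)"
  proof -
    have "(\<Sum>i<Suc n. w i * e i (unit 0)) = w 0 / X + (\<Sum>i=1..n. w i * e i (unit 0))"
      unfolding lessThan_Suc_atMost sum_atMost_split_0 by (simp add: e_def unit_def)
    also have "(\<Sum>i=1..n. w i * e i (unit 0)) = (\<Sum>i=1..n. w i * Y * \<zeta> ^ i)"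
      by (rule sum.cong) (auto simp: e_def unit_def)
    finally show ?thesis by (simp add: a f_unit)
  qed
  define P where "P = (\<Sum>k\<le>n. monom (a k) k)"
  have coeff_P: "coeff P k = (if k \<le> n then a k else 0)" for k
    by (simp add: P_def coeff_sum if_distrib cong: if_cong)
  have deg: "degree P \<le> n" by (rule degree_le) (simp add: coeff_P)
  have "poly (map_poly real_of_int P) \<zeta> = (\<Sum>k\<le>n. of_int (a k) * \<zeta> ^ k)"
    by (simp add: poly_of_int_eq_sum[OF deg] coeff_P)
  also have "\<dots> = of_int (a 0) + (\<Sum>k=1..n. (r k - w k * Y) * \<zeta> ^ k)"
    by (simp add: sum_atMost_split_0 a_pos)
  \<comment> \<open>The terms \<open>w k * Y * \<zeta> ^ k\<close> in \<open>a 0\<close> cancel the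
    corrections of the higher coefficients.\<close>
  also have "\<dots> = w 0 / X + (\<Sum>k\<le>n. r k * \<zeta> ^ k)"
    by (simp add: a_0 sum_atMost_split_0 left_diff_distrib sum_subtractf)
  finally have "poly (map_poly real_of_int P) \<zeta> = w 0 / X" using r by simp
  hence "\<bar>poly (map_poly real_of_int P) \<zeta>\<bar> \<le> 2 ^ Suc n / X"
    using w_le[of 0] \<open>X > 0\<close> by (simp add: divide_right_mono)
  moreover have "\<bar>of_int (coeff P i) - r i\<bar> \<le> 2 ^ Suc n * X powr \<mu>" if "i \<in> {1..n}" for i
    using that w_le[of i] Y by (simp add: coeff_P a_pos abs_mult flip: Y_def)
  ultimately show ?thesis using deg that by blast
qed

section \<open>A real root close to \<zeta>\<close>

lemma abs_power_diff_le:
  fixes x y R :: real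
  assumes "\<bar>x\<bar> \<le> R" "\<bar>y\<bar> \<le> R" "1 \<le> R"
  shows "\<bar>x ^ i - y ^ i\<bar> \<le> i * R ^ i * \<bar>x - y\<bar>"
proof (induction i)
  case (Suc i)
  have "\<bar>x ^ Suc i - y ^ Suc i\<bar> = \<bar>x * (x ^ i - y ^ i) + y ^ i * (x - y)\<bar>"
    by (simp add: algebra_simps)
  also have "\<dots> \<le> \<bar>x\<bar> * \<bar>x ^ i - y ^ i\<bar> + \<bar>y\<bar> ^ i * \<bar>x - y\<bar>"
    by (rule order.trans[OF abs_triangle_ineq]) (simp add: abs_mult power_abs)
  also have "\<dots> \<le> R * (i * R ^ i * \<bar>x - y\<bar>) + R ^ Suc i * \<bar>x - y\<bar>"
  proof (intro add_mono mult_mono Suc.IH mult_right_mono)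
    have "\<bar>y\<bar> ^ i \<le> R ^ i" by (rule power_mono) (use assms in auto)
    also have "\<dots> \<le> R ^ Suc i" by (rule power_increasing) (use assms in auto)
    finally show "\<bar>y\<bar> ^ i \<le> R ^ Suc i" .
  qed (use assms in auto)
  finally show ?case by (simp add: algebra_simps)
qed simp

lemma real_root_near_if_not_sim_sys:
  assumes "n \<ge> 1" and "\<mu> > 0"
  obtains C where "C \<ge> 1"
    "\<And>X. X \<ge> C \<Longrightarrow> \<not> sim_sys n \<zeta> \<mu> X \<Longrightarrow>
      \<exists>\<alpha> P. int_root P \<alpha> \<and> degree P \<le> n \<and> poly_height P \<le> C * X powr \<mu> \<and>
        \<bar>\<zeta> - \<alpha>\<bar> \<le> C * X powr (- 1 - \<mu>)"
proof -
  \<comment> \<open>\<open>K\<close> is the error constant of the polynomial found above, and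
    \<open>S\<close> bounds the variation of the powers within distance 1 of \<zeta>.
    \<open>M\<close> makes the slope \<open>M * Y\<close> exceed the disturbance
    \<open>K * Y * S\<close> by \<open>Y\<close>; \<open>C\<close> dominates all coefficient
    bounds.\<close>
  define K :: real where "K = 2 ^ Suc n"
  define R where "R = \<bar>\<zeta>\<bar> + 1"
  define S where "S = (\<Sum>i=1..n. i * R ^ i)"
  define M where "M = 1 + K * S"
  define C where "C = K + (M + K) * (1 + (\<Sum>i=1..n. R ^ i))"
  have K: "K \<ge> 1" unfolding K_def by (rule one_le_power) simp
  have R: "R \<ge> 1" by (simp add: R_def)
  have "real 1 * R ^ 1 \<le> S" unfolding S_def
    by (rule member_le_sum[where f = "\<lambda>i. real i * R ^ i"]) (use \<open>n \<ge> 1\<close> R in auto)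
  hence S: "S \<ge> 1" using R by simp
  hence "K * 1 \<le> K * S" using K by (intro mult_left_mono) auto
  hence M: "M > K" by (simp add: M_def)
  have T: "(\<Sum>i=1..n. R ^ i) \<ge> 0" using R by (intro sum_nonneg) auto
  have MK_C: "M + K \<le> C"
  proof -
    have "(M + K) * 1 \<le> (M + K) * (1 + (\<Sum>i=1..n. R ^ i))"
      using T M K by (intro mult_left_mono) auto
    thus ?thesis using K by (simp add: C_def)
  qed
  have main: "\<exists>\<alpha> P. int_root P \<alpha> \<and> degree P \<le> n \<and> poly_height P \<le> C * X powr \<mu> \<and>
      \<bar>\<zeta> - \<alpha>\<bar> \<le> C * X powr (- 1 - \<mu>)" if "X \<ge> C" and fails: "\<not> sim_sys n \<zeta> \<mu> X" for X
  proof -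
    have X: "X \<ge> 1" "X \<ge> K" using that MK_C M K by auto
    define Y where "Y = X powr \<mu>"
    have Y: "Y \<ge> 1" unfolding Y_def using X \<open>\<mu> > 0\<close> by (intro ge_one_powr_ge_zero) auto
    define r where "r i = (if i = 0 then - \<zeta> * M * Y else if i = 1 then M * Y else 0)" for i :: nat
    have r_sum: "(\<Sum>i=1..n. r i * x ^ i) = M * Y * x" for x
    proof -
      have "(\<Sum>i=1..n. r i * x ^ i) = (\<Sum>i=1..n. if i = 1 then M * Y * x else 0)"
        by (rule sum.cong) (auto simp: r_def)
      thus ?thesis using \<open>n \<ge> 1\<close> by simp
    qed
    have r_zero: "(\<Sum>i\<le>n. r i * \<zeta> ^ i) = 0" 
      unfolding sum_atMost_split_0 r_sum by (simp add: r_def)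
    have "X > 0" using X by simp
    obtain P :: "int poly" where deg: "degree P \<le> n"
      and P_small: "\<bar>poly (map_poly real_of_int P) \<zeta>\<bar> \<le> K / X"
      and P_near: "\<And>i. i \<in> {1..n} \<Longrightarrow> \<bar>of_int (coeff P i) - r i\<bar> \<le> K * Y"
      by (rule poly_near_target_if_not_sim_sys[OF \<open>X > 0\<close> fails r_zero, folded K_def Y_def], rule that)
    define p where "p = map_poly real_of_int P"
    define b where "b i = of_int (coeff P i) - r i" for i
    have p_eq: "poly p x = (\<Sum>i\<le>n. of_int (coeff P i) * x ^ i)" for x
      unfolding p_def by (rule poly_of_int_eq_sum[OF deg])
    have coeff_le: "\<bar>real_of_int (coeff P i)\<bar> \<le> (M + K) * Y" if "i \<in> {1..n}" for i
    proof -
      have "\<bar>r i\<bar> \<le> M * Y" using M K Y that by (simp add: r_def)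
      thus ?thesis using P_near[OF that] by (simp add: distrib_right)
    qed
    have "\<bar>real_of_int (coeff P i)\<bar> \<le> C * Y" if "i \<le> n" for i
    proof (cases "i = 0")
      case False
      hence "\<bar>real_of_int (coeff P i)\<bar> \<le> (M + K) * Y" using coeff_le that by simp
      also have "\<dots> \<le> C * Y" using MK_C Y by (intro mult_right_mono) auto
      finally show ?thesis .
    next
      case True
      \<comment> \<open>\<open>P_near\<close> says nothing about the constant coefficient; it is
        recovered from the value at \<zeta>.\<close>
      have "of_int (coeff P 0) = poly p \<zeta> - (\<Sum>i=1..n. of_int (coeff P i) * \<zeta> ^ i)"
        by (simp add: p_eq sum_atMost_split_0)
      hence "\<bar>real_of_int (coeff P 0)\<bar> \<le> \<bar>poly p \<zeta>\<bar> + \<bar>\<Sum>i=1..n. of_int (coeff P i) * \<zeta> ^ i\<bar>"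
        by simp
      also have "\<bar>poly p \<zeta>\<bar> \<le> K / 1"
        unfolding p_def by (rule order.trans[OF P_small frac_le]) (use K X in auto)
      also have "K / 1 \<le> K * Y" using K Y by simp
      also have "\<bar>\<Sum>i=1..n. of_int (coeff P i) * \<zeta> ^ i\<bar> \<le> (\<Sum>i=1..n. (M + K) * Y * R ^ i)"
      proof (rule order.trans[OF sum_abs sum_mono])
        fix i assume i: "i \<in> {1..n}"
        have "\<bar>\<zeta>\<bar> ^ i \<le> R ^ i" by (rule power_mono) (auto simp: R_def)
        thus "\<bar>of_int (coeff P i) * \<zeta> ^ i\<bar> \<le> (M + K) * Y * R ^ i"
          unfolding abs_mult power_abs using coeff_le[OF i] M K Y by (intro mult_mono) auto
      qed
      also have "K * Y + (\<Sum>i=1..n. (M + K) * Y * R ^ i) = (K + (M + K) * (\<Sum>i=1..n. R ^ i)) * Y"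
        by (simp add: sum_distrib_left algebra_simps)
      also have "\<dots> \<le> C * Y"
        unfolding C_def by (rule mult_right_mono) (use M K Y in \<open>auto simp: algebra_simps\<close>)
      finally show ?thesis using True by simp
    qed
    hence "\<bar>coeff P i\<bar> \<le> \<lfloor>C * Y\<rfloor>" if "i \<le> degree P" for i
      using that deg by (simp add: le_floor_iff)
    hence "poly_height P \<le> \<lfloor>C * Y\<rfloor>" by (rule poly_height_leI)
    hence height: "poly_height P \<le> C * Y" by (simp add: le_floor_iff)
    have "P \<noteq> 0"
    proof
      assume "P = 0"
      hence "M * Y \<le> K * Y" using P_near[of 1] \<open>n \<ge> 1\<close> M K Y by (simp add: r_def)
      thus False using M Y by simp
    qed
    have incr: "\<bar>poly p x - poly p \<zeta> - M * Y * (x - \<zeta>)\<bar> \<le> K * Y * S * \<bar>x - \<zeta>\<bar>"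
      if "\<bar>x - \<zeta>\<bar> \<le> 1" for x
    proof -
      have "poly p x - poly p \<zeta> - M * Y * (x - \<zeta>) = (\<Sum>i=1..n. b i * (x ^ i - \<zeta> ^ i))"
        using r_sum[of x] r_sum[of \<zeta>]
        by (simp add: p_eq sum_atMost_split_0 b_def algebra_simps sum.distrib sum_subtractf)
      also have "\<bar>\<dots>\<bar> \<le> (\<Sum>i=1..n. K * Y * (i * R ^ i * \<bar>x - \<zeta>\<bar>))"
      proof (rule order.trans[OF sum_abs sum_mono])
        fix i assume i: "i \<in> {1..n}"
        have "\<bar>x ^ i - \<zeta> ^ i\<bar> \<le> i * R ^ i * \<bar>x - \<zeta>\<bar>"
          by (rule abs_power_diff_le) (use that in \<open>auto simp: R_def\<close>)
        thus "\<bar>b i * (x ^ i - \<zeta> ^ i)\<bar> \<le> K * Y * (i * R ^ i * \<bar>x - \<zeta>\<bar>)"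
          unfolding abs_mult using P_near[OF i] K Y by (intro mult_mono) (auto simp: b_def)
      qed
      also have "\<dots> = K * Y * S * \<bar>x - \<zeta>\<bar>"
        by (simp add: S_def sum_distrib_left sum_distrib_right mult_ac)
      finally show ?thesis .
    qed
    \<comment> \<open>With \<open>Y * t = K / X\<close>, the surplus slope \<open>Y\<close> over
      distance \<open>t\<close> compensates the bound on \<open>poly p \<zeta>\<close>, which forces
      a sign change between \<open>\<zeta> - t\<close> and \<open>\<zeta> + t\<close>.\<close>
    define t where "t = K * X powr (- 1 - \<mu>)"
    have Yt: "Y * t = K / X"
      using \<open>X > 0\<close> by (simp add: t_def Y_def powr_diff powr_minus_divide field_simps)
    have t0: "t > 0" using K \<open>X > 0\<close> by (simp add: t_def)
    have "t * 1 \<le> t * Y" using t0 Y by (intro mult_left_mono) auto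
    also have "\<dots> \<le> 1" using Yt X by (simp add: mult.commute)
    finally have t1: "t \<le> 1" by simp
    have MY: "M * Y * t = K * Y * S * t + K / X"
      by (simp add: M_def algebra_simps Yt)
    have "poly p (\<zeta> - t) \<le> 0"
      using incr[of "\<zeta> - t"] t0 t1 MY P_small by (auto simp: p_def abs_le_iff)
    moreover have "0 \<le> poly p (\<zeta> + t)"
      using incr[of "\<zeta> + t"] t0 t1 MY P_small by (auto simp: p_def abs_le_iff)
    ultimately have "\<exists>\<alpha>. \<zeta> - t \<le> \<alpha> \<and> \<alpha> \<le> \<zeta> + t \<and> poly p \<alpha> = 0"
      by (intro IVT') (use t0 in \<open>auto intro!: continuous_intros\<close>)
    then obtain \<alpha> where \<alpha>: "\<zeta> - t \<le> \<alpha>" "\<alpha> \<le> \<zeta> + t" "poly p \<alpha> = 0" by blast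
    have "t \<le> C * X powr (- 1 - \<mu>)"
      unfolding t_def by (rule mult_right_mono) (use MK_C M K in auto)
    hence "\<bar>\<zeta> - \<alpha>\<bar> \<le> C * X powr (- 1 - \<mu>)" using \<alpha> by linarith
    moreover have "int_root P \<alpha>" using \<alpha> \<open>P \<noteq> 0\<close> by (simp add: int_root_def p_def)
    ultimately show ?thesis using deg height unfolding Y_def by blast
  qed
  show ?thesis by (rule that[OF _ main]) (use MK_C M K in auto)
qed

section \<open>Algebraic approximations of bounded height\<close>

text \<open>The error is measured by the height bound \<open>h\<close> rather than by
  \<open>H \<alpha>\<close>, which serves both exponents: arbitrarily large \<open>h\<close> for
  \<open>wstar\<close>, all large \<open>h\<close> for \<open>wstar_hat\<close>.\<close>

definition approximable :: "nat \<Rightarrow> real \<Rightarrow> real \<Rightarrow> real \<Rightarrow> real \<Rightarrow> bool" where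
  "approximable n \<zeta> C \<mu> h \<longleftrightarrow>
    (\<exists>\<alpha>. alg_deg_le n \<alpha> \<and> 1 \<le> H \<alpha> \<and> H \<alpha> \<le> h \<and> \<bar>\<zeta> - \<alpha>\<bar> \<le> C * h powr (- 1 - \<mu>))"

text \<open>The change of scale \<open>h = E * X powr \<mu>\<close>, with \<open>E\<close> absorbing
  the height constants, makes \<open>X powr (- 1 - \<mu>)\<close> a constant multiple of
  \<open>h powr (- 1 - 1 / \<mu>)\<close>.\<close>

lemma approximable_if_not_sim_sys:
  assumes "n \<ge> 1" and "\<mu> > 0"
  obtains E C X0 where "E > 0" "X0 \<ge> 1"
    "\<And>X. X \<ge> X0 \<Longrightarrow> \<not> sim_sys n \<zeta> \<mu> X \<Longrightarrow> approximable n \<zeta> C (1 / \<mu>) (E * X powr \<mu>)"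
proof -
  obtain K where K: "K \<ge> 1" and root: "\<And>X. X \<ge> K \<Longrightarrow> \<not> sim_sys n \<zeta> \<mu> X \<Longrightarrow>
      \<exists>\<alpha> P. int_root P \<alpha> \<and> degree P \<le> n \<and> poly_height P \<le> K * X powr \<mu> \<and>
        \<bar>\<zeta> - \<alpha>\<bar> \<le> K * X powr (- 1 - \<mu>)"
    using real_root_near_if_not_sim_sys[OF assms, of \<zeta>] by blast
  define L where "L = 2 ^ n * real (Suc n)"
  have L: "L > 0" by (simp add: L_def)
  define E where "E = L * K"
  have E: "E > 0" using L K by (simp add: E_def)
  show ?thesis
  proof (rule that[of E K "K * E powr (1 + 1 / \<mu>)"])
    fix X assume X: "X \<ge> K" "\<not> sim_sys n \<zeta> \<mu> X"
    obtain \<alpha> P where \<alpha>: "int_root P \<alpha>" "degree P \<le> n" "poly_height P \<le> K * X powr \<mu>"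
      "\<bar>\<zeta> - \<alpha>\<bar> \<le> K * X powr (- 1 - \<mu>)"
      using root[OF X] by blast
    have "H \<alpha> \<le> L * poly_height P" unfolding L_def by (rule H_bounds(2)[OF \<alpha>(1,2)])
    also have "\<dots> \<le> L * (K * X powr \<mu>)" using \<alpha>(3) L by (intro mult_left_mono) auto
    finally have "H \<alpha> \<le> E * X powr \<mu>" by (simp add: E_def mult.assoc)
    moreover have "X powr (- 1 - \<mu>) = E powr (1 + 1 / \<mu>) * (E * X powr \<mu>) powr (- 1 - 1 / \<mu>)"
    proof -
      have exps: "\<mu> * (- 1 - 1 / \<mu>) = - 1 - \<mu>" "1 + 1 / \<mu> + (- 1 - 1 / \<mu>) = 0"
        using assms(2) by (simp_all add: field_simps)
      have "E powr (1 + 1 / \<mu>) * (E * X powr \<mu>) powr (- 1 - 1 / \<mu>) =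
          E powr (1 + 1 / \<mu> + (- 1 - 1 / \<mu>)) * X powr (\<mu> * (- 1 - 1 / \<mu>))"
        using E X K by (simp only: powr_mult powr_powr powr_add mult.assoc)
      also have "\<dots> = X powr (- 1 - \<mu>)" unfolding exps using E by simp
      finally show ?thesis by simp
    qed
    ultimately show "approximable n \<zeta> (K * E powr (1 + 1 / \<mu>)) (1 / \<mu>) (E * X powr \<mu>)"
      unfolding approximable_def alg_deg_le_def
      using \<alpha> H_bounds(1)[OF \<alpha>(1,2)] by (auto simp: mult.assoc)
  qed (use E K in auto)
qed

text \<open>Exponent 0 makes both starred exponents nonnegative, as the convention
  \<open>1 / \<infinity> = 0\<close> requires.\<close>

lemma approximable_by_rationals:
  assumes "n \<ge> 1"
  obtains C where "\<And>h. h \<ge> C \<Longrightarrow> approximable n \<zeta> C 0 h"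
proof -
  define E where "E = 2 ^ n * real (Suc n) * (\<bar>\<zeta>\<bar> + 1)"
  have E: "E > 0" by (auto simp: E_def intro!: mult_pos_pos add_nonneg_pos)
  have "approximable n \<zeta> (2 * E) 0 h" if h: "h \<ge> 2 * E" for h
  proof -
    \<comment> \<open>The largest denominator for which the height bound \<open>q * E\<close> stays
      below \<open>h\<close>.\<close>
    define q where "q = \<lfloor>h / E\<rfloor>"
    define p where "p = \<lfloor>q * \<zeta>\<rfloor>"
    have "h / E \<ge> 2" using h E by (simp add: field_simps)
    hence q: "q \<ge> 1" by (simp add: q_def le_floor_iff)
    have q_h: "real_of_int q \<le> h / E" "h / E < q + 1" unfolding q_def by linarith+
    have p: "real_of_int p \<le> q * \<zeta>" "q * \<zeta> < p + 1" unfolding p_def by linarith+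
    define P where "P = [:- p, q:]"
    define \<alpha> where "\<alpha> = p / q"
    have root: "int_root P \<alpha>" using q by (simp add: int_root_def P_def \<alpha>_def map_poly_pCons)
    have deg: "degree P \<le> n" using assms q by (simp add: P_def)
    have pq: "\<bar>real_of_int p\<bar> \<le> q * (\<bar>\<zeta>\<bar> + 1)"
    proof -
      have "\<bar>q * \<zeta>\<bar> = q * \<bar>\<zeta>\<bar>" using q by (simp add: abs_mult)
      thus ?thesis using p q by (simp add: distrib_left)
    qed
    have "real_of_int q * 1 \<le> q * (\<bar>\<zeta>\<bar> + 1)" using q by (intro mult_left_mono) auto
    hence "\<bar>coeff P i\<bar> \<le> \<lfloor>q * (\<bar>\<zeta>\<bar> + 1)\<rfloor>" for i
      using pq q by (auto simp: P_def coeff_pCons le_floor_iff split: nat.split)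
    hence "poly_height P \<le> \<lfloor>q * (\<bar>\<zeta>\<bar> + 1)\<rfloor>" by (rule poly_height_leI)
    hence height: "poly_height P \<le> q * (\<bar>\<zeta>\<bar> + 1)" by (simp add: le_floor_iff)
    have "H \<alpha> \<le> 2 ^ n * real (Suc n) * poly_height P" by (rule H_bounds(2)[OF root deg])
    also have "\<dots> \<le> 2 ^ n * real (Suc n) * (q * (\<bar>\<zeta>\<bar> + 1))"
      by (intro mult_left_mono height) auto
    also have "\<dots> = q * E" by (simp only: E_def mult_ac)
    also have "\<dots> \<le> h" using q_h(1) E by (simp add: pos_le_divide_eq)
    finally have "H \<alpha> \<le> h" .
    moreover have "\<bar>\<zeta> - \<alpha>\<bar> \<le> 2 * E * h powr (- 1 - 0)"
    proof -
      have "\<zeta> - \<alpha> = (q * \<zeta> - p) / q" using q by (simp add: \<alpha>_def field_simps)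
      hence "\<bar>\<zeta> - \<alpha>\<bar> \<le> 1 / q" using p q by (simp add: abs_div divide_right_mono)
      \<comment> \<open>As \<open>q \<ge> 1\<close>,
        \<open>2 * q \<ge> q + 1 > h / E\<close>.\<close>
      also have "\<dots> \<le> 1 / (h / (2 * E))"
        using q_h q E h by (intro divide_left_mono) (auto simp: field_simps)
      also have "\<dots> = 2 * E * h powr (- 1 - 0)"
        using h E by (simp add: powr_minus_divide)
      finally show ?thesis .
    qed
    ultimately show ?thesis unfolding approximable_def alg_deg_le_def
      using root deg H_bounds(1)[OF root deg] by blast
  qed
  thus ?thesis by (rule that)
qed

section \<open>Passing to the suprema\<close>

text \<open>Working strictly below \<mu> leaves a power of \<open>h\<close> to absorb the constant
  \<open>C\<close>; the lower limit \<open>a\<close> permits assuming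
  \<open>\<nu> > - 1\<close>.\<close>

lemma ereal_le_if_all_less:
  fixes W :: ereal and a \<mu> :: real
  assumes "\<And>\<nu>. a < \<nu> \<Longrightarrow> \<nu> < \<mu> \<Longrightarrow> ereal \<nu> \<le> W" "a < \<mu>"
  shows "ereal \<mu> \<le> W"
proof (rule ccontr)
  assume "\<not> ?thesis"
  hence "max W (ereal a) < ereal \<mu>" using assms(2) by simp
  then obtain \<nu> where "max W (ereal a) < ereal \<nu>" "ereal \<nu> < ereal \<mu>"
    using ereal_dense2 by blast
  thus False using assms(1)[of \<nu>] by (auto dest: leD)
qed

lemma eventually_mult_powr_less:
  fixes C a d :: real
  assumes "a < 0" "d > 0"
  shows "eventually (\<lambda>h. C * h powr a < d) at_top"
proof -
  have "((\<lambda>h. C * h powr a) \<longlongrightarrow> C * 0) at_top"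
    by (intro tendsto_intros tendsto_neg_powr filterlim_ident assms)
  thus ?thesis using assms(2) by (intro order_tendstoD(2)) auto
qed

lemma eventually_mult_powr_le_powr:
  fixes C \<mu> \<nu> :: real
  assumes "\<nu> < \<mu>"
  shows "eventually (\<lambda>h. C * h powr (- 1 - \<mu>) \<le> h powr (- 1 - \<nu>)) at_top"
proof -
  have "eventually (\<lambda>h. C * h powr (\<nu> - \<mu>) < 1) at_top"
    by (rule eventually_mult_powr_less) (use assms in auto)
  thus ?thesis
  proof eventually_elim
    case (elim h)
    have "C * h powr (- 1 - \<mu>) = C * h powr (\<nu> - \<mu>) * h powr (- 1 - \<nu>)"
      by (simp add: mult.assoc algebra_simps flip: powr_add)
    also have "\<dots> \<le> 1 * h powr (- 1 - \<nu>)"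
      using elim by (intro mult_right_mono) auto
    finally show ?case by simp
  qed
qed

text \<open>Finitely many approximations would keep a positive distance from \<zeta>, which is not
  one of them, whereas the given ones come arbitrarily close.\<close>

lemma wstar_ge:
  assumes \<zeta>: "\<not> alg_deg_le n \<zeta>" and "\<mu> \<ge> 0"
    and approx: "\<And>h0. \<exists>h\<ge>h0. approximable n \<zeta> C \<mu> h"
  shows "wstar n \<zeta> \<ge> ereal \<mu>"
proof (rule ereal_le_if_all_less)
  \<comment> \<open>For \<open>\<nu> > - 1\<close> the exponent is negative, so replacing
    \<open>h\<close> by the smaller \<open>H \<alpha>\<close> weakens the bound.\<close>
  fix \<nu> :: real assume \<nu>: "- 1 < \<nu>" "\<nu> < \<mu>"
  define A where "A = {\<alpha>. alg_deg_le n \<alpha> \<and> \<bar>\<zeta> - \<alpha>\<bar> \<le> H \<alpha> powr (- \<nu> - 1)}"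
  have "infinite A"
  proof
    assume "finite A"
    then obtain d where d: "d > 0" "\<And>\<alpha>. \<alpha> \<in> A \<Longrightarrow> \<alpha> \<noteq> \<zeta> \<Longrightarrow> d \<le> dist \<zeta> \<alpha>"
      using finite_set_avoid by metis
    have "eventually (\<lambda>h. C * h powr (- 1 - \<mu>) \<le> h powr (- 1 - \<nu>) \<and> C * h powr (- 1 - \<mu>) < d) at_top"
      using \<nu> d(1) \<open>\<mu> \<ge> 0\<close>
      by (intro eventually_conj eventually_mult_powr_le_powr eventually_mult_powr_less) auto
    then obtain h0 where h0: "\<And>h. h \<ge> h0 \<Longrightarrow> C * h powr (- 1 - \<mu>) \<le> h powr (- 1 - \<nu>)"
        "\<And>h. h \<ge> h0 \<Longrightarrow> C * h powr (- 1 - \<mu>) < d"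
      unfolding eventually_at_top_linorder by blast
    obtain h where h: "h \<ge> h0" "approximable n \<zeta> C \<mu> h" using approx by blast
    then obtain \<alpha> where \<alpha>: "alg_deg_le n \<alpha>" "1 \<le> H \<alpha>" "H \<alpha> \<le> h"
        "\<bar>\<zeta> - \<alpha>\<bar> \<le> C * h powr (- 1 - \<mu>)"
      unfolding approximable_def by blast
    have "\<bar>\<zeta> - \<alpha>\<bar> \<le> h powr (- 1 - \<nu>)" using \<alpha>(4) h0(1)[OF h(1)] by simp
    also have "- 1 - \<nu> = - \<nu> - 1" by simp
    also have "h powr (- \<nu> - 1) \<le> H \<alpha> powr (- \<nu> - 1)"
      by (rule powr_mono2') (use \<nu> \<alpha> in auto)
    finally have "\<alpha> \<in> A" using \<alpha> by (simp add: A_def)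
    moreover have "\<alpha> \<noteq> \<zeta>" using \<alpha>(1) \<zeta> by blast
    ultimately show False using d(2)[of \<alpha>] \<alpha>(4) h0(2)[OF h(1)] by (simp add: dist_real_def)
  qed
  thus "ereal \<nu> \<le> wstar n \<zeta>" unfolding wstar_def A_def by (intro Sup_upper) auto
qed (use \<open>\<mu> \<ge> 0\<close> in simp)

text \<open>Only the factor \<open>h powr (- 1)\<close> is traded for
  \<open>H \<alpha> powr (- 1)\<close>, so \<nu> may have any sign.\<close>

lemma wstar_hat_ge:
  assumes approx: "\<And>h. h \<ge> h0 \<Longrightarrow> approximable n \<zeta> C \<mu> h"
  shows "wstar_hat n \<zeta> \<ge> ereal \<mu>"
proof (rule ereal_le_if_all_less[where a = "\<mu> - 1"])
  fix \<nu> :: real assume \<nu>: "\<nu> < \<mu>"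
  obtain h1 where h1: "\<And>h. h \<ge> h1 \<Longrightarrow> C * h powr (- 1 - \<mu>) \<le> h powr (- 1 - \<nu>)"
    using eventually_mult_powr_le_powr[OF \<nu>, of C] unfolding eventually_at_top_linorder by blast
  have "\<exists>\<alpha>. alg_deg_le n \<alpha> \<and> H \<alpha> \<le> h \<and> \<bar>\<zeta> - \<alpha>\<bar> \<le> H \<alpha> powr (- 1) * h powr (- \<nu>)"
    if h: "h \<ge> max h0 h1" for h
  proof -
    have "approximable n \<zeta> C \<mu> h" using h by (intro approx) simp
    then obtain \<alpha> where \<alpha>: "alg_deg_le n \<alpha>" "1 \<le> H \<alpha>" "H \<alpha> \<le> h"
        "\<bar>\<zeta> - \<alpha>\<bar> \<le> C * h powr (- 1 - \<mu>)"
      unfolding approximable_def by blast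
    have "\<bar>\<zeta> - \<alpha>\<bar> \<le> h powr (- 1 + - \<nu>)" using \<alpha>(4) h1[of h] h by simp
    also have "\<dots> = h powr (- 1) * h powr (- \<nu>)" by (rule powr_add)
    also have "\<dots> \<le> H \<alpha> powr (- 1) * h powr (- \<nu>)"
      by (intro mult_right_mono powr_mono2') (use \<alpha> in auto)
    finally show ?thesis using \<alpha> by blast
  qed
  thus "ereal \<nu> \<le> wstar_hat n \<zeta>" unfolding wstar_hat_def by (intro Sup_upper) blast
qed simp

text \<open>
  In \<^typ>\<open>ereal\<close> the value \<open>1 / 0\<close> is \<open>\<infinity>\<close>; the case \<open>W = 0\<close> is covered because \<open>\<mu>\<close> may be arbitrarily
  small.
\<close>

lemma inverse_le_if_all_greater:
  fixes W W' :: ereal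
  assumes "W' \<ge> 0" and le: "\<And>\<mu>. \<mu> > 0 \<Longrightarrow> W < ereal \<mu> \<Longrightarrow> ereal (1 / \<mu>) \<le> W'"
  shows "1 / W \<le> W'"
proof (rule ccontr)
  assume "\<not> ?thesis"
  hence "W' < 1 / W" by (simp only: not_le)
  then obtain z where z: "W' < ereal z" "ereal z < 1 / W"
    using ereal_dense2 by blast
  have "z > 0" using order.strict_trans1[OF \<open>W' \<ge> 0\<close> z(1)] by simp
  have "W < ereal (1 / z)"
  proof (cases W)
    case (real w)
    show ?thesis
    proof (cases "w > 0")
      case True
      hence "z < 1 / w" using z(2) real by (simp add: one_ereal_def)
      thus ?thesis using True \<open>z > 0\<close> real by (simp add: field_simps)
    next
      case False
      moreover have "0 < 1 / z" using \<open>z > 0\<close> by simp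
      ultimately have "w < 1 / z" by linarith
      thus ?thesis using real by simp
    qed
  qed (use z \<open>z > 0\<close> in auto)
  hence "ereal (1 / (1 / z)) \<le> W'" using \<open>z > 0\<close> by (intro le) auto
  thus False using z by simp
qed

theorem theorem2:
  fixes n :: nat and \<zeta> :: real
  assumes "n \<ge> 1" and "\<not> alg_deg_le n \<zeta>"
  shows "wstar n \<zeta> \<ge> 1 / wprime_hat n \<zeta> \<and> wstar_hat n \<zeta> \<ge> 1 / wprime n \<zeta>"
proof
  obtain C where C: "\<And>h. h \<ge> C \<Longrightarrow> approximable n \<zeta> C 0 h"
    using approximable_by_rationals[OF assms(1)] by blast
  show "1 / wprime_hat n \<zeta> \<le> wstar n \<zeta>"
  proof (rule inverse_le_if_all_greater)
    have "\<exists>h\<ge>h0. approximable n \<zeta> C 0 h" for h0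
      using C by (intro exI[of _ "max h0 C"]) auto
    thus "0 \<le> wstar n \<zeta>" using wstar_ge[OF assms(2), of 0 C] by (simp add: zero_ereal_def)
  next
    fix \<mu> :: real assume \<mu>: "\<mu> > 0" "wprime_hat n \<zeta> < ereal \<mu>"
    \<comment> \<open>Above the uniform exponent the system fails for arbitrarily large
      \<open>X\<close>.\<close>
    have "\<not> (\<exists>X0. \<forall>X\<ge>X0. sim_sys n \<zeta> \<mu> X)"
    proof
      assume "\<exists>X0. \<forall>X\<ge>X0. sim_sys n \<zeta> \<mu> X"
      hence "ereal \<mu> \<le> wprime_hat n \<zeta>" unfolding wprime_hat_def by (intro Sup_upper) blast
      thus False using \<mu>(2) by simp
    qed
    hence fails: "\<exists>X\<ge>X0. \<not> sim_sys n \<zeta> \<mu> X" for X0 by blast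
    obtain E C X0 where E: "E > 0" "X0 \<ge> 1" and approx:
      "\<And>X. X \<ge> X0 \<Longrightarrow> \<not> sim_sys n \<zeta> \<mu> X \<Longrightarrow> approximable n \<zeta> C (1 / \<mu>) (E * X powr \<mu>)"
      by (rule approximable_if_not_sim_sys[OF assms(1) \<mu>(1), of \<zeta>], rule that)
    have "\<exists>h\<ge>h0. approximable n \<zeta> C (1 / \<mu>) h" for h0
    proof -
      \<comment> \<open>Large enough for \<open>E * X powr \<mu>\<close> to reach \<open>h0\<close>;
        \<open>max h0 0\<close> keeps the base nonnegative so that the powers cancel.\<close>
      obtain X where X: "X \<ge> max X0 ((max h0 0 / E) powr (1 / \<mu>))" "\<not> sim_sys n \<zeta> \<mu> X"
        using fails by blast
      have "max h0 0 / E = ((max h0 0 / E) powr (1 / \<mu>)) powr \<mu>"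
        using E \<mu>(1) by (simp add: powr_powr)
      also have "\<dots> \<le> X powr \<mu>" by (rule powr_mono2) (use X \<mu>(1) in auto)
      finally have "h0 \<le> E * X powr \<mu>" using E by (simp add: pos_divide_le_eq mult.commute)
      moreover have "approximable n \<zeta> C (1 / \<mu>) (E * X powr \<mu>)" using X by (intro approx) auto
      ultimately show ?thesis by blast
    qed
    thus "ereal (1 / \<mu>) \<le> wstar n \<zeta>" using \<mu>(1) by (intro wstar_ge[OF assms(2)]) auto
  qed
  show "1 / wprime n \<zeta> \<le> wstar_hat n \<zeta>"
  proof (rule inverse_le_if_all_greater)
    show "0 \<le> wstar_hat n \<zeta>" using wstar_hat_ge[OF C] by (simp add: zero_ereal_def)
  next
    fix \<mu> :: real assume \<mu>: "\<mu> > 0" "wprime n \<zeta> < ereal \<mu>"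
    \<comment> \<open>Above the ordinary exponent the system fails at every large
      \<open>X\<close>.\<close>
    have "\<not> (\<forall>X0. \<exists>X\<ge>X0. sim_sys n \<zeta> \<mu> X)"
    proof
      assume "\<forall>X0. \<exists>X\<ge>X0. sim_sys n \<zeta> \<mu> X"
      hence "ereal \<mu> \<le> wprime n \<zeta>" unfolding wprime_def by (intro Sup_upper) blast
      thus False using \<mu>(2) by simp
    qed
    then obtain X1 where fails: "\<And>X. X \<ge> X1 \<Longrightarrow> \<not> sim_sys n \<zeta> \<mu> X" by blast
    obtain E C X0 where E: "E > 0" "X0 \<ge> 1" and approx:
      "\<And>X. X \<ge> X0 \<Longrightarrow> \<not> sim_sys n \<zeta> \<mu> X \<Longrightarrow> approximable n \<zeta> C (1 / \<mu>) (E * X powr \<mu>)"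
      by (rule approximable_if_not_sim_sys[OF assms(1) \<mu>(1), of \<zeta>], rule that)
    define X2 where "X2 = max X0 X1"
    have "approximable n \<zeta> C (1 / \<mu>) h" if h: "h \<ge> E * X2 powr \<mu>" for h
    proof -
      \<comment> \<open>Solving \<open>E * X powr \<mu> = h\<close> reaches every large
        \<open>h\<close>, not only a sequence of values.\<close>
      define X where "X = (h / E) powr (1 / \<mu>)"
      have X2: "X2 \<ge> 1" using E by (simp add: X2_def)
      have "X2 powr \<mu> \<le> h / E" using h E by (simp add: pos_le_divide_eq mult.commute)
      hence "(X2 powr \<mu>) powr (1 / \<mu>) \<le> X"
        unfolding X_def using \<mu>(1) by (intro powr_mono2) auto
      hence "X2 \<le> X" using \<mu>(1) X2 by (simp add: powr_powr)
      hence X: "X \<ge> X0" "X \<ge> X1" by (auto simp: X2_def)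
      have "0 \<le> E * X2 powr \<mu>" using E by simp
      hence "0 \<le> h" using h by linarith
      hence "E * X powr \<mu> = h" using E \<mu>(1) h by (simp add: X_def powr_powr)
      thus ?thesis using approx[OF X(1) fails[OF X(2)]] by simp
    qed
    thus "ereal (1 / \<mu>) \<le> wstar_hat n \<zeta>" by (rule wstar_hat_ge)
  qed
qed

end
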